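(* Let $R$ be a commutative ring with $1\ne0$, $n\ge1$, and let $f\in P_n=R[X_1,\dots,X_n]$ with $\delta f\ge\mathbf 1$. (a) For every $n$-dimensional sequence $s$ over $R$ indexed by $-\mathbb{N}^n$, $$f\cdot\Gamma(s)=\sum_{k=0}^{2^n-2}\beta^\times_{\mathbf i(k)}(f,s)+\Gamma(f\circ s),$$ where $\mathrm{Supp}(\beta^\times_{\mathbf i(k)}(f,s))\subseteq\beta_k(-\infty,\delta f]$ for $0\le k\le2^n-2$. (b) $f\in\mathrm{Ann}(s)$ if and only if $\Gamma(s)=\Big(\sum_{k=0}^{2^n-2}\beta^\times_{\mathbf i(k)}(f,s)\Big)/f$ (that is, $f\cdot\Gamma(s)=\sum_{k=0}^{2^n-2}\beta^\times_{\mathbf i(k)}(f,s)$). (c) If $f$ is monic, $G\in L_n$ and $\mathrm{Supp}(G)\subseteq(-\mathbf 1,\delta f-\mathbf 1]$, then $X^{\mathbf 1}G/f\in S_n$, and the sequence $s$ defined by $\Gamma(s)=X^{\mathbf 1}G/f$ is a linear recurring sequence with $f\in\mathrm{Ann}(s)$ and $X^{\mathbf 1}G=\sum_{k=0}^{2^n-2}\beta^\times_{\mathbf i(k)}(f,s)$.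
   Context: $\mathbb{N}=\{0,1,2,\dots\}$; $\mathbf 0=(0,\dots,0)$, $\mathbf 1=(1,\dots,1)$; vectors are ordered componentwise; $X^a=X_1^{a_1}\cdots X_n^{a_n}$. $S_n=R[[X_1^{-1},\dots,X_n^{-1}]]$; $L_n=R((X_1^{-1},\dots,X_n^{-1}))$ is the ring of formal sums $\sum_{a\in\mathbb{Z}^n}G_aX^a$ whose support $\mathrm{Supp}(G)=\{a:G_a\ne0\}$ lies in $\{a:a\le d\}$ for some $d\in\mathbb{Z}^n$. For $a,b\in\mathbb{Z}^n$, $(a,b]=\{c\in\mathbb{Z}^n:c\le b\text{ and not }c\le a\}$ and $(-\infty,b]=\{c:c\le b\}$. For $f\in P_n$, $\delta f$ is the vector of partial degrees; $f$ is monic if the coefficient of $X^{\delta f}$ in $f$ is $1$. A sequence is $s:-\mathbb{N}^n\to R$; $P_n$ acts by $(f\circ s)_b=\sum_af_as_{b-a}$ $(b\le\mathbf 0)$; $\mathrm{Ann}(s)=\{f\in P_n:f\circ s=0\}$; $s$ is a linear recurring sequence if $\mathrm{Ann}(s)\ne\{0\}$; $\Gamma(s)=\sum_{a\le\mathbf 0}s_aX^a\in S_n$. The same notions are used for variables and sequences indexed by any non-empty finite index set. Border partition: for $0\le k\le2^n-1$ write $k=\sum_{i=1}^nb_i(k)2^{i-1}$ with $b_i(k)\in\{0,1\}$. For $d\ge\mathbf 1$, $\beta_k(-\infty,d]=\prod_{i=1}^nI_i$, where $I_i=(-\infty,0]$ if $b_i(k)=1$ and $I_i=[1,d_i]$ if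 $b_i(k)=0$ (intervals in $\mathbb{Z}$). Put $\mathbf i(k)=\{i:b_i(k)=1\}$. Divided differences: for a polynomial $g$ and $a\ge\mathbf 0$, $\nu^ag=\sum_{a\le b\le\delta g}g_bX^{b-a}$ (empty sum $0$). For a non-empty proper subset $\mathbf i$ of $\{1,\dots,n\}$ with complement $\mathbf i'$, let $X_{\mathbf i}$, $X_{\mathbf i'}$ be the corresponding groups of variables (for $a\in\mathbb{Z}^{\mathbf i}$, $X_{\mathbf i}^a=\prod_{i\in\mathbf i}X_i^{a_i}$, and an unexponented $X_{\mathbf i'}$ used as a factor means $\prod_{i\in\mathbf i'}X_i$); for $a\in\mathbb{Z}^{\mathbf i},a'\in\mathbb{Z}^{\mathbf i'}$ let $(a,a')\in\mathbb{Z}^n$ be the combined vector; let $\delta,\delta'$ be the restrictions of $\delta f$ to $\mathbf i,\mathbf i'$; $\mathbf 0',\mathbf 1'$ are the zero and all-ones vectors in $\mathbb{Z}^{\mathbf i'}$. For $\mathbf 0\le a\le\delta$, $f^{(a)}=\sum_{\mathbf 0'\le a'\le\delta'}f_{(a,a')}X_{\mathbf i'}^{a'}\in R[X_{\mathbf i'}]$. For $a'\in\mathbb{N}^{\mathbf i'}$, $s^{(-a')}:-\mathbb{N}^{\mathbf i}\to R$ is $s^{(-a')}_a=s_{(a,-a')}$. Define $$\beta^\times_{\mathbf i}(f,s)=X_{\mathbf i'}\sum_{\mathbf 0\le a\le\delta}\ \sum_{\mathbf 0'\le a'\le\delta'-\mathbf 1'}\big(\nu^{a'+\mathbf 1'}f^{(a)}\big)\cdot\Gamma\big(X_{\mathbf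 i}^a\circ s^{(-a')}\big),$$ where $\nu^{a'+\mathbf 1'}f^{(a)}\in R[X_{\mathbf i'}]$ and $\Gamma(X_{\mathbf i}^a\circ s^{(-a')})$ is a power series in the inverses of the variables $X_{\mathbf i}$. For $k=0$ (so $\mathbf i(0)=\emptyset$) define $$\beta^\times_{\mathbf i(0)}(f,s)=X^{\mathbf 1}\sum_{\mathbf 0\le a\le\delta f-\mathbf 1}s_{-a}\,\nu^{a+\mathbf 1}f.$$ *)

theory Defs
  imports Main "HOL-Library.FuncSet" "HOL-Library.Function_Algebras"
begin

text \<open>
  Exponent vectors indexed by a finite set \<open>I\<close> of naturals are functions \<open>nat \<Rightarrow> int\<close> vanishing
  outside \<open>I\<close>. Hence the order and the addition of functions are the componentwise ones, \<open>\<int>\<^sup>J\<close> is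
  contained in \<open>\<int>\<^sup>I\<close> for \<open>J \<subseteq> I\<close>, and the vector combined from \<open>a \<in> \<int>\<^sup>J\<close> and
  \<open>a' \<in> \<int>\<^sup>I\<^sup>-\<^sup>J\<close> is simply \<open>a + a'\<close>.
  The notation \<open>{a..b}\<close> is therefore a box of exponent vectors.
\<close>

type_synonym expo = "nat \<Rightarrow> int"

definition expos :: "nat set \<Rightarrow> expo set" where
  "expos I = {a. \<forall>i. i \<notin> I \<longrightarrow> a i = 0}"

definition nonpos :: "nat set \<Rightarrow> expo set" where
  "nonpos I = {a \<in> expos I. a \<le> 0}"

definition ones :: "nat set \<Rightarrow> expo" where
  "ones I = (\<lambda>i. if i \<in> I then 1 else 0)"

definition restr :: "nat set \<Rightarrow> expo \<Rightarrow> expo" where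
  "restr J d = (\<lambda>i. if i \<in> J then d i else 0)"

definition interval :: "nat set \<Rightarrow> expo \<Rightarrow> expo \<Rightarrow> expo set" where
  "interval I a b = {c \<in> expos I. c \<le> b \<and> \<not> c \<le> a}"

text \<open>
  A formal sum \<open>\<Sum> G\<^sub>a X\<^sup>a\<close> is its coefficient function. Polynomials and power series in the inverse
  variables are particular formal sums, and sums of formal sums are the pointwise ones. The product
  is \<open>\<odot>\<close> (not the pointwise \<open>*\<close> of functions); its index set is finite on \<open>Laurent I\<close>, \<open>I\<close> finite.
\<close>

type_synonym 'a formal = "expo \<Rightarrow> 'a"

definition Supp :: "'a::zero formal \<Rightarrow> expo set" where
  "Supp G = {a. G a \<noteq> 0}"

definition Laurent :: "nat set \<Rightarrow> 'a::zero formal set" where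
  "Laurent I = {G. \<exists>d \<in> expos I. Supp G \<subseteq> {a \<in> expos I. a \<le> d}}"

definition PowerSeries :: "nat set \<Rightarrow> 'a::zero formal set" where
  "PowerSeries I = {G. Supp G \<subseteq> nonpos I}"

definition Polys :: "nat set \<Rightarrow> 'a::zero formal set" where
  "Polys I = {f. finite (Supp f) \<and> Supp f \<subseteq> {a \<in> expos I. 0 \<le> a}}"

definition mult :: "'a::comm_ring_1 formal \<Rightarrow> 'a formal \<Rightarrow> 'a formal" (infixl "\<odot>" 70) where
  "F \<odot> G = (\<lambda>c. \<Sum>(a, b) \<in> {(a, b). a \<in> Supp F \<and> b \<in> Supp G \<and> a + b = c}. F a * G b)"

definition scale :: "'a::comm_ring_1 \<Rightarrow> 'a formal \<Rightarrow> 'a formal" where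
  "scale r F = (\<lambda>c. r * F c)"

definition monom :: "'a::comm_ring_1 \<Rightarrow> expo \<Rightarrow> 'a formal" where
  "monom r a = (\<lambda>b. if b = a then r else 0)"

text \<open>Only meaningful when the quotient exists and is unique, e.g. when \<open>f\<close> is a unit.\<close>

definition quot :: "nat set \<Rightarrow> 'a::comm_ring_1 formal \<Rightarrow> 'a formal \<Rightarrow> 'a formal" where
  "quot I F f = (THE H. H \<in> Laurent I \<and> f \<odot> H = F)"

text \<open>The vector of partial degrees; inserting \<open>0\<close> only fixes the value \<open>0\<close> for the zero polynomial.\<close>

definition pdeg :: "'a::zero formal \<Rightarrow> expo" where
  "pdeg f = (\<lambda>i. Max (insert 0 ((\<lambda>a. a i) ` Supp f)))"

definition monic :: "'a::comm_ring_1 formal \<Rightarrow> bool" where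
  "monic f \<longleftrightarrow> f (pdeg f) = 1"

text \<open>
  A sequence indexed by \<open>-\<nat>\<^sup>I\<close> is an extensional function on \<open>nonpos I\<close>, so that equality of
  sequences is equality of functions.
\<close>

definition seqs :: "nat set \<Rightarrow> (expo \<Rightarrow> 'a) set" where
  "seqs I = nonpos I \<rightarrow>\<^sub>E UNIV"

definition act :: "nat set \<Rightarrow> 'a::comm_ring_1 formal \<Rightarrow> (expo \<Rightarrow> 'a) \<Rightarrow> (expo \<Rightarrow> 'a)" where
  "act I f s = (\<lambda>b\<in>nonpos I. \<Sum>a\<in>Supp f. f a * s (b - a))"

definition Ann :: "nat set \<Rightarrow> (expo \<Rightarrow> 'a::comm_ring_1) \<Rightarrow> 'a formal set" where
  "Ann I s = {f \<in> Polys I. act I f s = (\<lambda>b\<in>nonpos I. 0)}"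

definition linear_recurring :: "nat set \<Rightarrow> (expo \<Rightarrow> 'a::comm_ring_1) \<Rightarrow> bool" where
  "linear_recurring I s \<longleftrightarrow> Ann I s \<noteq> {0}"

definition Gam :: "nat set \<Rightarrow> (expo \<Rightarrow> 'a::comm_ring_1) \<Rightarrow> 'a formal" where
  "Gam I s = (\<lambda>a. if a \<in> nonpos I then s a else 0)"

definition divdiff :: "expo \<Rightarrow> 'a::comm_ring_1 formal \<Rightarrow> 'a formal" where
  "divdiff a g = (\<Sum>b\<in>{a..pdeg g}. monom (g b) (b - a))"

text \<open>
  \<open>poly_slice J' f a\<close> is \<open>f\<^sup>(\<^sup>a\<^sup>)\<close>, a polynomial in the variables indexed by \<open>J'\<close>, and
  \<open>seq_slice J s a'\<close> is \<open>s\<^sup>(\<^sup>-\<^sup>a\<^sup>'\<^sup>)\<close>, a sequence indexed by \<open>-\<nat>\<^sup>J\<close>.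
\<close>

definition poly_slice :: "nat set \<Rightarrow> 'a::comm_ring_1 formal \<Rightarrow> expo \<Rightarrow> 'a formal" where
  "poly_slice J' f a = (\<Sum>a'\<in>{0..restr J' (pdeg f)}. monom (f (a + a')) a')"

definition seq_slice :: "nat set \<Rightarrow> (expo \<Rightarrow> 'a) \<Rightarrow> expo \<Rightarrow> (expo \<Rightarrow> 'a)" where
  "seq_slice J s a' = (\<lambda>a\<in>nonpos J. s (a - a'))"

definition border_prod ::
    "nat set \<Rightarrow> nat set \<Rightarrow> 'a::comm_ring_1 formal \<Rightarrow> (expo \<Rightarrow> 'a) \<Rightarrow> 'a formal" where
  "border_prod I J f s =
    (if J = {} then
       monom 1 (ones I) \<odot>
         (\<Sum>a\<in>{0..pdeg f - ones I}. scale (s (- a)) (divdiff (a + ones I) f))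
     else
       let J' = I - J in
       monom 1 (ones J') \<odot>
         (\<Sum>a\<in>{0..restr J (pdeg f)}. \<Sum>a'\<in>{0..restr J' (pdeg f) - ones J'}.
            divdiff (a' + ones J') (poly_slice J' f a)
              \<odot> Gam J (act J (monom 1 a) (seq_slice J s a'))))"

text \<open>The binary digit \<open>b\<^sub>i(k)\<close>, numbered from \<open>i = 1\<close>, is \<open>bit k (i - 1)\<close>.\<close>

definition border_index :: "nat \<Rightarrow> nat \<Rightarrow> nat set" where
  "border_index n k = {i \<in> {1..n}. bit k (i - 1)}"

definition border :: "nat \<Rightarrow> nat \<Rightarrow> expo \<Rightarrow> expo set" where
  "border n k d = {c \<in> expos {1..n}. \<forall>i\<in>{1..n}.
     c i \<in> (if bit k (i - 1) then {..0} else {1..d i})}"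

end

theory Submission
  imports Defs
begin

text \<open>
  Everything is a comparison of coefficients. The coefficient of \<open>X\<^sup>c\<close> in \<open>f \<odot> Gam I s\<close> is
  \<open>\<Sum>b. f b * s (c - b)\<close>, where only the \<open>b \<ge> c\<close> contribute. The set \<open>J\<close> of coordinates at which
  \<open>c\<close> is nonpositive decides which term of the decomposition carries this coefficient: if
  \<open>J = I\<close>, the condition \<open>b \<ge> c\<close> is automatic and the coefficient is that of \<open>Gam I (act I f s)\<close>;
  if \<open>J\<close> is a proper subset, then \<open>b\<close> can be written uniquely as \<open>a + a' + c'\<close>, where \<open>c'\<close> is the
  positive part of \<open>c\<close>, and summing over \<open>a\<close> and \<open>a'\<close> gives the border product for \<open>J\<close>
  (\<open>border_prod_apply\<close>). The sets of exponents belonging to different \<open>J\<close> are disjoint and cover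
  everything, which gives the decomposition and the support condition of (a); binary digits
  translate \<open>k < 2 ^ n - 1\<close> into proper subsets \<open>J\<close>. Part (b) follows, because a sequence is
  determined by its generating function.

  For (c), a monic \<open>f\<close> has \<open>X\<^sup>\<delta>\<^sup>f\<close> as its only term of the highest total degree. Hence the
  equation \<open>f \<odot> H = K\<close> determines the coefficients of \<open>H\<close> one total degree after the other, starting
  from the top: this yields a quotient in \<open>PowerSeries I\<close> when the exponents of \<open>K\<close> are at most
  \<open>\<delta>f\<close> (\<open>monic_division_exists\<close>) and its uniqueness in \<open>Laurent I\<close> (\<open>monic_mult_eq_0\<close>). When
  \<open>K = X\<^sup>1 G\<close>, no exponent of \<open>K\<close> is nonpositive, so the part \<open>Gam I (act I f s)\<close> of
  \<open>f \<odot> Gam I s = K\<close> is zero.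
\<close>

section \<open>Exponent vectors\<close>

lemma expos_plus [simp]: "a \<in> expos I \<Longrightarrow> b \<in> expos I \<Longrightarrow> a + b \<in> expos I"
  and expos_minus [simp]: "a \<in> expos I \<Longrightarrow> b \<in> expos I \<Longrightarrow> a - b \<in> expos I"
  and expos_zero [simp]: "0 \<in> expos I"
  and expos_ones [simp]: "ones I \<in> expos I"
  and expos_restr [simp]: "restr I a \<in> expos I"
  by (auto simp: expos_def ones_def restr_def)

lemma restr_disjoint_plus:
  assumes "a \<in> expos J'" "b \<in> expos J" "J \<inter> J' = {}"
  shows "restr J' (a + b) = a" "restr J (a + b) = b"
proof -
  have "a i = 0" if "i \<notin> J'" for i using assms(1) that by (simp add: expos_def)
  moreover have "b i = 0" if "i \<notin> J" for i using assms(2) that by (simp add: expos_def)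
  ultimately show "restr J' (a + b) = a" "restr J (a + b) = b"
    using assms(3) by (auto simp: restr_def fun_eq_iff)
qed

lemma expos_mono: "J \<subseteq> I \<Longrightarrow> a \<in> expos J \<Longrightarrow> a \<in> expos I"
  by (auto simp: expos_def)

lemma expos_between:
  assumes "a \<in> expos I" "d \<in> expos I" "a \<le> b" "b \<le> d"
  shows "b \<in> expos I"
proof -
  have "b i = 0" if "i \<notin> I" for i
    using assms(1,2) that le_funD[OF assms(3), of i] le_funD[OF assms(4), of i]
    by (simp add: expos_def)
  then show ?thesis by (simp add: expos_def)
qed

lemma finite_box:
  assumes "finite I" "a \<in> expos I" "d \<in> expos I"
  shows "finite {a..d}"
proof (rule finite_subset)
  show "finite {b. \<forall>i. (i \<in> I \<longrightarrow> b i \<in> (\<Union>i\<in>I. {a i..d i})) \<and> (i \<notin> I \<longrightarrow> b i = 0)}"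
    using assms(1) by (intro finite_set_of_finite_funs) auto
  show "{a..d} \<subseteq> {b. \<forall>i. (i \<in> I \<longrightarrow> b i \<in> (\<Union>i\<in>I. {a i..d i})) \<and> (i \<notin> I \<longrightarrow> b i = 0)}"
  proof
    fix b assume "b \<in> {a..d}"
    then have "b \<in> expos I" "\<And>i. a i \<le> b i \<and> b i \<le> d i"
      using expos_between[OF assms(2,3), of b] by (auto simp: le_fun_def)
    then show "b \<in> {b. \<forall>i. (i \<in> I \<longrightarrow> b i \<in> (\<Union>i\<in>I. {a i..d i})) \<and> (i \<notin> I \<longrightarrow> b i = 0)}"
      by (auto simp: expos_def)
  qed
qed

lemma sum_expo_less:
  fixes b d :: expo
  assumes "finite I" "b \<in> expos I" "d \<in> expos I" "b \<le> d" "b \<noteq> d"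
  shows "sum b I < sum d I"
proof (rule sum_strict_mono_ex1)
  obtain i where i: "b i \<noteq> d i" using assms(5) by (auto simp: fun_eq_iff)
  then have "i \<in> I" using assms(2,3) by (cases "i \<in> I") (simp_all add: expos_def)
  moreover have "b i < d i" using i le_funD[OF assms(4), of i] by simp
  ultimately show "\<exists>i\<in>I. b i < d i" by blast
qed (use assms in \<open>auto simp: le_fun_def\<close>)

section \<open>Coefficients of formal sums\<close>

lemma sum_formal_apply: "(\<Sum>x\<in>A. F x) c = (\<Sum>x\<in>A. F x c)" for F :: "'b \<Rightarrow> 'a::comm_ring_1 formal"
  by (induction A rule: infinite_finite_induct) auto

text \<open>
  Summing over a finite set that contains the support of the first factor makes the product visibly
  linear in the second factor, whose support may be infinite.
\<close>
lemma mult_apply: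
  assumes "finite S" "Supp F \<subseteq> S"
  shows "(F \<odot> G) c = (\<Sum>b\<in>S. F b * G (c - b))"
proof -
  have "{(a, b). a \<in> Supp F \<and> b \<in> Supp G \<and> a + b = c}
      = (\<lambda>b. (b, c - b)) ` {b \<in> Supp F. c - b \<in> Supp G}"
    by (auto simp: image_iff)
  then have "(F \<odot> G) c = (\<Sum>b\<in>{b \<in> Supp F. c - b \<in> Supp G}. F b * G (c - b))"
    by (simp add: mult_def sum.reindex inj_on_def)
  also have "\<dots> = (\<Sum>b\<in>S. F b * G (c - b))"
    using assms by (intro sum.mono_neutral_left) (auto simp: Supp_def)
  finally show ?thesis .
qed

lemma monom_mult_apply: "(monom 1 a \<odot> F) c = F (c - a)"
  by (subst mult_apply[of "{a}"]) (auto simp: Supp_def monom_def)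

text \<open>
  When the factors have disjoint sets of variables, there is only one way to split an exponent
  of the product.
\<close>
lemma mult_disjoint_variables_apply:
  assumes "Supp F \<subseteq> expos J'" "Supp G \<subseteq> expos J" "J \<inter> J' = {}"
  shows "(F \<odot> G) c = (if c \<in> expos (J \<union> J') then F (restr J' c) * G (restr J c) else 0)"
proof (cases "c \<in> expos (J \<union> J') \<and> restr J' c \<in> Supp F \<and> restr J c \<in> Supp G")
  case True
  then have split: "restr J' c + restr J c = c"
    using assms(3) by (auto simp: expos_def restr_def fun_eq_iff)
  have "{(a, b). a \<in> Supp F \<and> b \<in> Supp G \<and> a + b = c} = {(restr J' c, restr J c)}"
  proof (intro equalityI subsetI)
    fix p assume "p \<in> {(a, b). a \<in> Supp F \<and> b \<in> Supp G \<and> a + b = c}"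
    then obtain a b where p: "p = (a, b)" and ab: "a \<in> Supp F" "b \<in> Supp G" "a + b = c"
      by blast
    then have "restr J' c = a" "restr J c = b"
      using restr_disjoint_plus[OF subsetD[OF assms(1)] subsetD[OF assms(2)] assms(3)] by blast+
    then show "p \<in> {(restr J' c, restr J c)}" by (simp add: p)
  next
    fix p assume "p \<in> {(restr J' c, restr J c)}"
    then show "p \<in> {(a, b). a \<in> Supp F \<and> b \<in> Supp G \<and> a + b = c}"
      using True split by blast
  qed
  then show ?thesis using True by (simp add: mult_def)
next
  case False
  have "a + b \<noteq> c" if "a \<in> Supp F" "b \<in> Supp G" for a b
  proof
    assume "a + b = c"
    moreover from this have "a = restr J' c" "b = restr J c"
      using restr_disjoint_plus[OF subsetD[OF assms(1)] subsetD[OF assms(2)] assms(3)] that by auto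
    moreover have "a + b \<in> expos (J \<union> J')"
      using that assms by (auto intro!: expos_plus intro: expos_mono[rotated])
    ultimately show False using False that by auto
  qed
  then have *: "{(a, b). a \<in> Supp F \<and> b \<in> Supp G \<and> a + b = c} = {}" by auto
  show ?thesis using False unfolding mult_def * by (auto simp: Supp_def)
qed

section \<open>Partial degrees and divided differences\<close>

lemma le_pdeg:
  assumes "f \<in> Polys I" "b \<in> Supp f"
  shows "b \<le> pdeg f"
  using assms by (auto simp: pdeg_def le_fun_def Polys_def)

lemma pdeg_expos:
  assumes "f \<in> Polys I"
  shows "pdeg f \<in> expos I"
proof -
  have "pdeg f i = 0" if "i \<notin> I" for i
  proof -
    have "insert 0 ((\<lambda>a. a i) ` Supp f) = {0}"
      using assms that by (auto simp: Polys_def expos_def)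
    then show ?thesis unfolding pdeg_def by (simp only: Max_singleton)
  qed
  then show ?thesis by (simp add: expos_def)
qed

lemma divdiff_apply:
  assumes "finite I" "g \<in> Polys I" "a \<in> expos I"
  shows "divdiff a g e = (if 0 \<le> e then g (e + a) else 0)"
proof -
  have "finite {a..pdeg g}"
    using assms by (simp add: finite_box pdeg_expos)
  moreover have "e = b - a \<longleftrightarrow> b = e + a" for b
    by (auto simp: fun_eq_iff)
  ultimately have "divdiff a g e = (if e + a \<in> {a..pdeg g} then g (e + a) else 0)"
    by (simp add: divdiff_def sum_formal_apply monom_def)
  moreover have "a \<le> e + a \<longleftrightarrow> 0 \<le> e" by (auto simp: le_fun_def)
  moreover have "g (e + a) = 0" if "\<not> e + a \<le> pdeg g"
    using le_pdeg[OF assms(2)] that by (auto simp: Supp_def)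
  ultimately show ?thesis by auto
qed

lemma poly_slice_apply:
  assumes "finite I" "f \<in> Polys I" "J' \<subseteq> I" "a \<in> expos (I - J')"
  shows "poly_slice J' f a e = (if e \<in> expos J' then f (a + e) else 0)"
proof -
  let ?B = "{0..restr J' (pdeg f)}"
  have fin: "finite ?B"
    using assms by (intro finite_box[of J']) (auto intro: finite_subset)
  have "poly_slice J' f a e = (if e \<in> ?B then f (a + e) else 0)"
    using fin by (simp add: poly_slice_def sum_formal_apply monom_def)
  moreover have "e \<in> expos J'" if "e \<in> ?B"
    using that expos_between[OF expos_zero expos_restr] by auto
  moreover have "e \<in> ?B" if "e \<in> expos J'" "f (a + e) \<noteq> 0"
  proof -
    have "a + e \<in> Supp f" using that by (simp add: Supp_def)
    then have "a + e \<le> pdeg f" "0 \<le> a + e"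
      using le_pdeg[OF assms(2)] assms(2) by (auto simp: Polys_def)
    then have le: "a i + e i \<le> pdeg f i" "0 \<le> a i + e i" for i
      by (simp_all add: le_fun_def)
    have "0 \<le> e i \<and> e i \<le> restr J' (pdeg f) i" for i
    proof (cases "i \<in> J'")
      case True
      then have "a i = 0" using assms(4) by (simp add: expos_def)
      with le[of i] True show ?thesis by (simp add: restr_def)
    next
      case False
      then have "e i = 0" using \<open>e \<in> expos J'\<close> by (simp add: expos_def)
      with False show ?thesis by (simp add: restr_def)
    qed
    then show ?thesis by (simp add: le_fun_def)
  qed
  ultimately show ?thesis by metis
qed

lemma poly_slice_Polys:
  assumes "finite I" "f \<in> Polys I" "J' \<subseteq> I" "a \<in> expos (I - J')"
  shows "poly_slice J' f a \<in> Polys J'"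
proof -
  have "Supp (poly_slice J' f a) \<subseteq> {0..restr J' (pdeg f)}"
    unfolding Supp_def poly_slice_def sum_formal_apply monom_def
    by (auto elim!: sum.not_neutral_contains_not_neutral split: if_splits simp del: sum.delta sum.delta')
  moreover have "finite {0..restr J' (pdeg f)}"
    using assms by (intro finite_box[of J']) (auto intro: finite_subset)
  moreover have "{0..restr J' (pdeg f)} \<subseteq> {b \<in> expos J'. 0 \<le> b}"
    using expos_between[OF expos_zero expos_restr] by auto
  ultimately show ?thesis
    unfolding Polys_def by (blast intro: finite_subset)
qed

lemma Gam_act_monom_apply:
  "Gam J (act J (monom 1 a) t) c = (if c \<in> nonpos J then t (c - a) else 0)"
proof -
  have "Supp (monom (1::'a) a) = {a}" by (auto simp: Supp_def monom_def)
  then show ?thesis by (auto simp: Gam_def act_def monom_def)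
qed

section \<open>Border products\<close>

definition octant :: "nat set \<Rightarrow> nat set \<Rightarrow> expo set" where
  "octant I J = {c \<in> expos I. \<forall>i\<in>I. c i \<le> 0 \<longleftrightarrow> i \<in> J}"

lemma octant_iff:
  assumes "J \<subseteq> I"
  shows "c \<in> octant I J \<longleftrightarrow>
    c \<in> expos I \<and> restr J c \<in> nonpos J \<and> 0 \<le> restr (I - J) c - ones (I - J)"
proof -
  have "restr J c \<in> nonpos J \<longleftrightarrow> (\<forall>i\<in>J. c i \<le> 0)"
    by (auto simp: nonpos_def le_fun_def restr_def expos_def)
  moreover have "0 \<le> restr (I - J) c - ones (I - J) \<longleftrightarrow> (\<forall>i\<in>I - J. 1 \<le> c i)"
    by (auto simp: le_fun_def restr_def ones_def)
  ultimately show ?thesis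
    using assms by (auto simp: octant_def) force+
qed

text \<open>
  The two cases in the definition of the border product take a common form here. In each summand,
  \<open>X\<^sub>J\<^sup>a\<close> and the divided difference shift the slices of \<open>s\<close> and \<open>f\<close>, so that its coefficient at \<open>c\<close>
  is a single product of an entry of \<open>f\<close> and an entry of \<open>s\<close>. The truncations in \<open>Gam\<close> and
  \<open>divdiff\<close> confine \<open>c\<close> to the octant. For empty \<open>J\<close> only \<open>a = 0\<close> occurs.
\<close>
lemma border_prod_sum:
  assumes "finite I" "f \<in> Polys I" "J \<subseteq> I"
  shows "border_prod I J f s c = (if c \<in> octant I J then
    \<Sum>a\<in>{0..restr J (pdeg f)}. \<Sum>a'\<in>{0..restr (I - J) (pdeg f) - ones (I - J)}.
      f (a + restr (I - J) c + a') * s (restr J c - a - a') else 0)"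
proof (cases "J = {}")
  case True
  have box: "{0..0::expo} = {0}" by auto
  have r: "restr {} x = 0" for x :: expo by (auto simp: restr_def)
  have rI: "restr I x = x" if "x \<in> expos I" for x
    using that by (auto simp: restr_def expos_def)
  have nn: "0 \<in> nonpos {}" by (simp add: nonpos_def)
  have box_expos: "a \<in> expos I" if "a \<in> {0..pdeg f - ones I}" for a
    using that expos_between[OF expos_zero expos_minus[OF pdeg_expos[OF assms(2)] expos_ones]] by auto
  have "border_prod I J f s c
      = (\<Sum>a\<in>{0..pdeg f - ones I}. s (- a) * divdiff (a + ones I) f (c - ones I))"
    using True by (simp add: border_prod_def monom_mult_apply sum_formal_apply scale_def)
  also have "\<dots> = (\<Sum>a\<in>{0..pdeg f - ones I}.
      s (- a) * (if 0 \<le> c - ones I then f (c - ones I + (a + ones I)) else 0))"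
    by (intro sum.cong refl) (simp only: divdiff_apply[OF assms(1,2)] box_expos expos_plus expos_ones)
  finally have eq: "border_prod I J f s c = (\<Sum>a\<in>{0..pdeg f - ones I}.
      s (- a) * (if 0 \<le> c - ones I then f (c - ones I + (a + ones I)) else 0))" .
  have shift: "c - ones I + (a + ones I) = c + a" for a
    by (simp add: fun_eq_iff)
  show ?thesis
  proof (cases "c \<in> expos I")
    case True
    show ?thesis
      unfolding eq using True \<open>J = {}\<close>
      by (simp add: shift octant_iff r rI nn box pdeg_expos[OF assms(2)] mult.commute)
  next
    case False
    have "f (c + a) = 0" if "a \<in> expos I" for a
    proof (rule ccontr)
      assume "f (c + a) \<noteq> 0"
      then have "c + a \<in> expos I" using assms(2) by (auto simp: Polys_def Supp_def)
      with that False show False by (auto simp: expos_def)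
    qed
    then have "border_prod I J f s c = 0"
      unfolding eq shift using box_expos by (intro sum.neutral) simp
    then show ?thesis using False by (simp add: octant_def)
  qed
next
  case False
  define J' where "J' = I - J"
  have J': "J' \<subseteq> I" "I - J' = J" "J \<inter> J' = {}" "J \<union> J' = I" "finite J'"
    using assms by (auto simp: J'_def)
  have restr_minus: "restr J' (c - ones J') = restr J' c - ones J'"
    "restr J (c - ones J') = restr J c"
    by (auto simp: restr_def ones_def J'_def fun_eq_iff)
  have expos_c: "c - ones J' \<in> expos I \<longleftrightarrow> c \<in> expos I"
    using J'(1) by (auto simp: expos_def ones_def subset_iff)
  have summand: "(divdiff (a' + ones J') (poly_slice J' f a)
        \<odot> Gam J (act J (monom 1 a) (seq_slice J s a'))) (c - ones J')
      = (if c \<in> octant I J then f (a + restr J' c + a') * s (restr J c - a - a') else 0)"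
    if "a \<in> {0..restr J (pdeg f)}" "a' \<in> {0..restr J' (pdeg f) - ones J'}" for a a'
  proof -
    have a: "a \<in> expos J" "a' \<in> expos J'"
      using that expos_between[OF expos_zero expos_restr]
        expos_between[OF expos_zero expos_minus[OF expos_restr expos_ones]] by auto
    let ?D = "divdiff (a' + ones J') (poly_slice J' f a)"
    let ?H = "Gam J (act J (monom 1 a) (seq_slice J s a'))"
    have slice: "poly_slice J' f a \<in> Polys J'"
      using assms a J' by (intro poly_slice_Polys[of I]) auto
    have slice_apply: "poly_slice J' f a e = (if e \<in> expos J' then f (a + e) else 0)" for e
      using assms a J' by (intro poly_slice_apply[of I]) auto
    have D: "?D e = (if 0 \<le> e \<and> e \<in> expos J' then f (a + (e + (a' + ones J'))) else 0)" for e
    proof -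
      have "e + (a' + ones J') \<in> expos J' \<longleftrightarrow> e \<in> expos J'"
        using a(2) by (auto simp: expos_def ones_def)
      then show ?thesis
        using slice a J' by (simp add: divdiff_apply[of J'] slice_apply)
    qed
    have H: "?H e = (if e \<in> nonpos J then s (e - a - a') else 0)" for e
    proof -
      have "e - a \<in> nonpos J" if "e \<in> nonpos J"
      proof -
        have "0 \<le> a" using \<open>a \<in> {0..restr J (pdeg f)}\<close> by simp
        then have "e i - a i \<le> 0" for i
          using that by (auto simp: nonpos_def le_fun_def intro: order_trans)
        then show ?thesis using that a by (auto simp: nonpos_def le_fun_def)
      qed
      then show ?thesis by (simp add: Gam_act_monom_apply seq_slice_def)
    qed
    have "(?D \<odot> ?H) (c - ones J') =
        (if c \<in> expos I then ?D (restr J' c - ones J') * ?H (restr J c) else 0)"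
      by (subst mult_disjoint_variables_apply[of _ J' _ J])
        (use J' D H in \<open>auto simp: Supp_def nonpos_def restr_minus expos_c split: if_splits\<close>)
    moreover have "?D (restr J' c - ones J') =
        (if 0 \<le> restr J' c - ones J' then f (a + restr J' c + a') else 0)"
    proof -
      have "a + (restr J' c - ones J' + (a' + ones J')) = a + restr J' c + a'"
        by (simp add: fun_eq_iff)
      then show ?thesis unfolding D by (simp add: add.assoc)
    qed
    ultimately show ?thesis
      unfolding octant_iff[OF assms(3), folded J'_def] H by simp
  qed
  have "border_prod I J f s c = (\<Sum>a\<in>{0..restr J (pdeg f)}. \<Sum>a'\<in>{0..restr J' (pdeg f) - ones J'}.
      (divdiff (a' + ones J') (poly_slice J' f a)
        \<odot> Gam J (act J (monom 1 a) (seq_slice J s a'))) (c - ones J'))"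
    using False by (simp add: border_prod_def Let_def J'_def monom_mult_apply sum_formal_apply)
  also have "\<dots> = (\<Sum>a\<in>{0..restr J (pdeg f)}. \<Sum>a'\<in>{0..restr J' (pdeg f) - ones J'}.
      (if c \<in> octant I J then f (a + restr J' c + a') * s (restr J c - a - a') else 0))"
    by (intro sum.cong refl summand)
  finally show ?thesis by (simp add: J'_def)
qed

text \<open>
  For \<open>c\<close> in the octant of \<open>J\<close>, a term \<open>f b * s (c - b)\<close> of the coefficient of \<open>X\<^sup>c\<close> in the product
  exists only if \<open>b \<ge> c\<close>. Then \<open>b = a + (c' + a')\<close>, where \<open>a\<close> is the part of \<open>b\<close> in the
  coordinates \<open>J\<close>, \<open>c'\<close> is the positive part of \<open>c\<close> and \<open>a' \<ge> 0\<close>; since \<open>c'\<close> is at least \<open>1\<close> in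
  the coordinates outside \<open>J\<close>, \<open>a'\<close> is at most the degree minus \<open>1\<close>. So the double sum
  ranges over exactly the terms that can be nonzero.
\<close>
lemma border_prod_apply:
  assumes "finite I" "f \<in> Polys I" "J \<subseteq> I"
  shows "border_prod I J f s c = (if c \<in> octant I J then (f \<odot> Gam I s) c else 0)"
proof (cases "c \<in> octant I J")
  case True
  let ?A = "{0..restr J (pdeg f)}" and ?A' = "{0..restr (I - J) (pdeg f) - ones (I - J)}"
  let ?\<phi> = "\<lambda>(a, a'). a + restr (I - J) c + a'"
  have c: "c \<in> expos I" "\<And>i. i \<in> J \<Longrightarrow> c i \<le> 0"
    using True assms(3) by (auto simp: octant_def)
  have c_pos: "1 \<le> c i" if "i \<in> I" "i \<notin> J" for i
  proof -
    have "\<not> c i \<le> 0" using True that by (simp add: octant_def)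
    then show ?thesis by simp
  qed
  have A: "a \<in> expos J" if "a \<in> ?A" for a
    using that expos_between[OF expos_zero expos_restr] by auto
  have A': "a' \<in> expos (I - J)" if "a' \<in> ?A'" for a'
    using that expos_between[OF expos_zero expos_minus[OF expos_restr expos_ones]] by auto
  have fin: "finite ?A" "finite ?A'"
    using assms finite_box[of J 0 "restr J (pdeg f)"]
      finite_box[of "I - J" 0 "restr (I - J) (pdeg f) - ones (I - J)"]
    by (auto intro: finite_subset)
  have split: "c - (a + restr (I - J) c + a') = restr J c - a - a'" for a a'
    using c(1) assms(3) by (auto simp: restr_def expos_def fun_eq_iff)
  have inj: "inj_on ?\<phi> (?A \<times> ?A')"
  proof (rule inj_onI, clarify)
    fix a a' b b'
    assume in_A: "a \<in> ?A" "a' \<in> ?A'" "b \<in> ?A" "b' \<in> ?A'"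
      and "a + restr (I - J) c + a' = b + restr (I - J) c + b'"
    then have eq: "a i + a' i = b i + b' i" for i
      by (auto simp: fun_eq_iff)
    have "a i = b i \<and> a' i = b' i" for i
      using eq[of i] A[OF in_A(1)] A'[OF in_A(2)] A[OF in_A(3)] A'[OF in_A(4)]
      by (cases "i \<in> J") (auto simp: expos_def)
    then show "a = b \<and> a' = b'" by auto
  qed
  have s: "s (c - ?\<phi> p) = Gam I s (c - ?\<phi> p)" if p: "p \<in> ?A \<times> ?A'" for p
  proof -
    obtain a a' where [simp]: "p = (a, a')" by (cases p)
    have "a \<in> expos I" "a' \<in> expos I" "0 \<le> a" "0 \<le> a'"
      using p A[of a] A'[of a'] assms(3) by (auto intro: expos_mono[rotated])
    moreover have "restr J c \<in> nonpos I"
      using c assms(3) by (auto simp: nonpos_def restr_def expos_def le_fun_def)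
    ultimately have "restr J c - a - a' \<in> nonpos I"
      unfolding nonpos_def le_fun_def by (auto, smt (verit))
    then show ?thesis by (simp add: Gam_def split)
  qed
  have "border_prod I J f s c = (\<Sum>p\<in>?A \<times> ?A'. f (?\<phi> p) * s (c - ?\<phi> p))"
    using True by (simp add: border_prod_sum[OF assms] sum.cartesian_product split split_def)
  also have "\<dots> = (\<Sum>p\<in>?A \<times> ?A'. f (?\<phi> p) * Gam I s (c - ?\<phi> p))"
    by (intro sum.cong refl arg_cong2[where f = times] s)
  also have "\<dots> = (\<Sum>b\<in>?\<phi> ` (?A \<times> ?A'). f b * Gam I s (c - b))"
    by (simp add: sum.reindex[OF inj] o_def)
  also have "\<dots> = (\<Sum>b\<in>Supp f. f b * Gam I s (c - b))"
  proof (rule sum.mono_neutral_cong)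
    show "finite (Supp f)" using assms(2) by (simp add: Polys_def)
    show "finite (?\<phi> ` (?A \<times> ?A'))" using fin by simp
    fix b assume b: "b \<in> Supp f - ?\<phi> ` (?A \<times> ?A')"
    have "c - b \<notin> nonpos I"
    proof
      assume "c - b \<in> nonpos I"
      then have cb: "c i \<le> b i" for i by (auto simp: nonpos_def le_fun_def)
      have bd: "0 \<le> b i" "b i \<le> pdeg f i" for i
        using b le_pdeg[OF assms(2), of b] assms(2) by (auto simp: Polys_def le_fun_def)
      have bI: "b \<in> expos I" using b assms(2) by (auto simp: Polys_def)
      have "restr J b \<in> ?A"
        using bd by (auto simp: le_fun_def restr_def)
      moreover have "restr (I - J) (b - c) \<in> ?A'"
      proof -
        have "0 \<le> restr (I - J) (b - c) i \<and>
            restr (I - J) (b - c) i \<le> (restr (I - J) (pdeg f) - ones (I - J)) i" for i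
          using cb[of i] bd[of i] c_pos[of i] by (auto simp: restr_def ones_def)
        then show ?thesis by (auto simp: le_fun_def)
      qed
      moreover have "b = ?\<phi> (restr J b, restr (I - J) (b - c))"
        using bI assms(3) by (auto simp: restr_def expos_def fun_eq_iff)
      ultimately show False using b by blast
    qed
    then show "f b * Gam I s (c - b) = 0" by (simp add: Gam_def)
  qed (auto simp: Supp_def)
  also have "\<dots> = (f \<odot> Gam I s) c"
    using assms(2) by (subst mult_apply[of "Supp f"]) (auto simp: Polys_def)
  finally show ?thesis using True by simp
qed (use border_prod_sum[OF assms] in simp)

lemma mult_Gam_outside_expos:
  assumes "f \<in> Polys I" "c \<notin> expos I"
  shows "(f \<odot> Gam I s) c = 0"
proof -
  have "c - b \<notin> nonpos I" if "b \<in> Supp f" for b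
  proof
    assume "c - b \<in> nonpos I"
    moreover have "b \<in> expos I" using that assms(1) by (auto simp: Polys_def)
    ultimately have "c - b + b \<in> expos I" by (intro expos_plus) (auto simp: nonpos_def)
    then show False using assms(2) by simp
  qed
  then show ?thesis
    using assms(1) by (subst mult_apply[of "Supp f"]) (auto simp: Polys_def Gam_def)
qed

text \<open>
  For nonpositive \<open>c\<close> every \<open>c - b\<close> with \<open>b\<close> in the support of \<open>f\<close> is nonpositive, so no term is cut
  off.
\<close>
lemma Gam_act_apply:
  assumes "f \<in> Polys I"
  shows "Gam I (act I f s) c = (if c \<in> nonpos I then (f \<odot> Gam I s) c else 0)"
proof (cases "c \<in> nonpos I")
  case True
  have "c - b \<in> nonpos I" if "b \<in> Supp f" for b
  proof -
    have "b \<in> expos I" "0 \<le> b" using that assms by (auto simp: Polys_def)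
    moreover have "c i - b i \<le> 0" for i
      using True \<open>0 \<le> b\<close> by (auto simp: nonpos_def le_fun_def intro: order_trans)
    ultimately show ?thesis using True by (auto simp: nonpos_def le_fun_def)
  qed
  moreover have "(f \<odot> Gam I s) c = (\<Sum>b\<in>Supp f. f b * Gam I s (c - b))"
    using assms by (subst mult_apply[of "Supp f"]) (auto simp: Polys_def)
  ultimately show ?thesis
    using True by (auto simp: Gam_def act_def intro!: sum.cong)
qed (simp add: Gam_def)

text \<open>
  The octants of the subsets of \<open>I\<close> partition the exponents, so exactly one summand on the right
  carries a given coefficient of the left side.
\<close>
theorem mult_Gam_eq_border_sum:
  assumes "finite I" "f \<in> Polys I"
  shows "f \<odot> Gam I s = (\<Sum>J\<in>Pow I - {I}. border_prod I J f s) + Gam I (act I f s)"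
proof (rule ext)
  fix c :: expo
  let ?Jc = "{i \<in> I. c i \<le> 0}"
  let ?m = "(f \<odot> Gam I s) c"
  show "?m = ((\<Sum>J\<in>Pow I - {I}. border_prod I J f s) + Gam I (act I f s)) c"
  proof (cases "c \<in> expos I")
    case True
    then have oct: "c \<in> octant I J \<longleftrightarrow> J = ?Jc" if "J \<subseteq> I" for J
      using that by (auto simp: octant_def)
    have np: "c \<in> nonpos I \<longleftrightarrow> ?Jc = I"
    proof -
      have "c i \<le> 0" if "i \<notin> I" for i using True that by (simp add: expos_def)
      then show ?thesis using True by (auto simp: nonpos_def le_fun_def)
    qed
    have "(\<Sum>J\<in>Pow I - {I}. border_prod I J f s) c = (\<Sum>J\<in>Pow I - {I}. if J = ?Jc then ?m else 0)"
      unfolding sum_formal_apply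
      by (intro sum.cong refl) (use oct in \<open>auto simp: border_prod_apply[OF assms]\<close>)
    also have "\<dots> = (if ?Jc = I then 0 else ?m)"
      using assms(1) by (subst sum.delta) auto
    finally show ?thesis
      by (simp add: Gam_act_apply[OF assms(2)] np)
  next
    case False
    have "(\<Sum>J\<in>Pow I - {I}. border_prod I J f s) c = 0"
      unfolding sum_formal_apply
      by (intro sum.neutral) (use False in \<open>auto simp: border_prod_apply[OF assms] octant_def\<close>)
    moreover have "Gam I (act I f s) c = 0"
      using False by (simp add: Gam_def nonpos_def)
    ultimately show ?thesis
      by (simp add: mult_Gam_outside_expos[OF assms(2) False])
  qed
qed

lemma mult_Gam_bounded:
  assumes "f \<in> Polys I" "(f \<odot> Gam I s) c \<noteq> 0"
  shows "c \<le> pdeg f"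
proof -
  have "(f \<odot> Gam I s) c = (\<Sum>b\<in>Supp f. f b * Gam I s (c - b))"
    using assms by (subst mult_apply[of "Supp f"]) (auto simp: Polys_def)
  with assms(2) have "(\<Sum>b\<in>Supp f. f b * Gam I s (c - b)) \<noteq> 0" by simp
  then obtain b where "b \<in> Supp f" "f b * Gam I s (c - b) \<noteq> 0"
    by (rule sum.not_neutral_contains_not_neutral)
  then have "c \<le> b"
    by (auto simp: Gam_def nonpos_def le_fun_def split: if_splits)
  also have "b \<le> pdeg f" using \<open>b \<in> Supp f\<close> le_pdeg[OF assms(1)] by simp
  finally show ?thesis .
qed

section \<open>Numbering the border by binary digits\<close>

lemma border_index_bij: "bij_betw (border_index n) {..<2 ^ n} (Pow {1..n})"
proof -
  have inj: "inj_on (border_index n) {..<2 ^ n}"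
  proof (rule inj_onI)
    fix k l :: nat
    assume k: "k \<in> {..<2 ^ n}" and l: "l \<in> {..<2 ^ n}" and eq: "border_index n k = border_index n l"
    show "k = l"
    proof (rule bit_eqI)
      fix j
      have high: "\<not> bit m j" if "m < 2 ^ n" "n \<le> j" for m :: nat
      proof -
        have "m < 2 ^ j" using that by (meson less_le_trans one_le_numeral power_increasing)
        then show ?thesis by (simp add: bit_iff_odd)
      qed
      show "bit k j \<longleftrightarrow> bit l j"
      proof (cases "j < n")
        case True
        then have "Suc j \<in> border_index n k \<longleftrightarrow> Suc j \<in> border_index n l" using eq by simp
        with True show ?thesis by (simp add: border_index_def)
      qed (use high k l in auto)
    qed
  qed
  moreover have "border_index n ` {..<2 ^ n} = Pow {1..n}"
  proof (rule card_subset_eq)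
    show "border_index n ` {..<2 ^ n} \<subseteq> Pow {1..n}" by (auto simp: border_index_def)
  qed (simp_all add: card_image[OF inj] card_Pow)
  ultimately show ?thesis by (simp add: bij_betw_def)
qed

text \<open>
  The number \<open>2 ^ n - 1\<close>, whose \<open>n\<close> digits are all \<open>1\<close>, corresponds to the full set \<open>{1..n}\<close>.
\<close>
lemma border_index_bij_proper:
  assumes "1 \<le> n"
  shows "bij_betw (border_index n) {0..2 ^ n - 2} (Pow {1..n} - {{1..n}})"
proof -
  have digits: "bit (2 ^ n - 1 :: nat) j \<longleftrightarrow> j < n" for j
    unfolding mask_eq_exp_minus_1[symmetric] bit_mask_iff by simp
  have "border_index n (2 ^ n - 1) = {1..n}"
    unfolding border_index_def digits by auto
  moreover have "(2::nat) ^ 1 \<le> 2 ^ n" using assms by (intro power_increasing) auto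
  then have "{0..2 ^ n - 2} = {..<2 ^ n} - {2 ^ n - 1 :: nat}"
    by auto
  ultimately show ?thesis
    using bij_betw_DiffI[OF border_index_bij, of n "{2 ^ n - 1}" "{{1..n}}"]
    by (simp add: bij_betw_def)
qed

section \<open>Division by a monic polynomial\<close>

text \<open>
  The total degree is additive and strictly monotone, and the partial degree bounds the support
  of \<open>f\<close> componentwise, so all other terms of \<open>f\<close> have a lower total degree. Both the existence
  and the uniqueness of the quotient rest on this.
\<close>
lemma sum_expo_raise:
  assumes "finite I" "f \<in> Polys I" "b \<in> Supp f" "b \<noteq> pdeg f"
  shows "sum c I < sum (c + pdeg f - b) I"
proof -
  have "sum b I < sum (pdeg f) I"
    using assms le_pdeg[OF assms(2,3)] pdeg_expos[OF assms(2)]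
    by (intro sum_expo_less) (auto simp: Polys_def)
  then show ?thesis by (simp add: sum.distrib sum_subtractf)
qed

lemma monic_mult_apply:
  assumes "f \<in> Polys I" "monic f"
  shows "(f \<odot> H) (c + pdeg f)
    = H c + (\<Sum>b\<in>Supp f - {pdeg f}. f b * H (c + pdeg f - b))"
proof -
  have "pdeg f \<in> Supp f" using assms(2) by (simp add: monic_def Supp_def)
  moreover have "(f \<odot> H) (c + pdeg f) = (\<Sum>b\<in>Supp f. f b * H (c + pdeg f - b))"
    using assms(1) by (subst mult_apply[of "Supp f"]) (auto simp: Polys_def)
  ultimately show ?thesis
    using assms by (simp add: sum.remove[of _ "pdeg f"] Polys_def monic_def)
qed

lemma monic_division_exists:
  assumes "finite I" "f \<in> Polys I" "monic f"
    and K: "Supp K \<subseteq> {c \<in> expos I. c \<le> pdeg f}"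
  shows "\<exists>H \<in> PowerSeries I. f \<odot> H = K"
proof -
  \<comment> \<open>The recursion goes down in the total degree. The summand 1 keeps the measure positive at every
    \<open>c \<in> nonpos I\<close>, so that it decreases even when the total degree becomes positive.\<close>
  define rel where "rel = measure (\<lambda>c :: expo. nat (1 - sum c I))"
  define step where "step = (\<lambda>h c. if c \<in> nonpos I
    then K (c + pdeg f) - (\<Sum>b\<in>Supp f - {pdeg f}. f b * h (c + pdeg f - b)) else 0)"
  define H where "H = wfrec rel step"
  have H: "H c = step H c" for c
  proof -
    have "wf rel" by (simp add: rel_def)
    then have "H c = step (cut H rel c) c" unfolding H_def by (rule wfrec)
    also have "\<dots> = step H c"
    proof (cases "c \<in> nonpos I")
      case True
      then have "sum c I \<le> 0" by (auto simp: nonpos_def le_fun_def intro: sum_nonpos)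
      then have "(c + pdeg f - b, c) \<in> rel" if "b \<in> Supp f - {pdeg f}" for b
        using sum_expo_raise[OF assms(1,2), of b c] that
        by (simp add: rel_def del: minus_apply plus_fun_apply)
      then show ?thesis using True by (simp add: step_def cut_apply)
    qed (simp add: step_def)
    finally show ?thesis .
  qed
  have "H \<in> PowerSeries I"
    using H by (auto simp: PowerSeries_def Supp_def step_def)
  moreover have "f \<odot> H = K"
  proof
    fix e
    define c where "c = e - pdeg f"
    have e: "e = c + pdeg f" by (simp add: c_def)
    show "(f \<odot> H) e = K e"
    proof (cases "c \<in> nonpos I")
      case True
      then show ?thesis
        using H[of c] by (simp add: e monic_mult_apply[OF assms(2,3)] step_def)
    next
      case False
      have "K e = 0"
      proof (rule ccontr)
        assume "K e \<noteq> 0"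
        then have "e \<in> expos I" "e \<le> pdeg f" using K by (auto simp: Supp_def)
        then have "c \<in> nonpos I"
          using pdeg_expos[OF assms(2)] by (auto simp: c_def nonpos_def le_fun_def)
        with False show False ..
      qed
      moreover have "H (e - b) = 0" if b: "b \<in> Supp f" for b
      proof -
        have "e - b \<notin> nonpos I"
        proof
          assume "e - b \<in> nonpos I"
          moreover have "b \<in> expos I" "b \<le> pdeg f"
            using b assms(2) le_pdeg by (auto simp: Polys_def)
          moreover have "c = (e - b) + (b - pdeg f)" by (simp add: c_def)
          moreover have "(e - b) + (b - pdeg f) \<le> 0"
            using \<open>e - b \<in> nonpos I\<close> \<open>b \<le> pdeg f\<close>
            by (intro add_nonpos_nonpos) (auto simp: nonpos_def le_fun_def)
          ultimately have "c \<in> nonpos I"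
            using pdeg_expos[OF assms(2)] unfolding nonpos_def
            by (metis (mono_tags, lifting) expos_minus expos_plus mem_Collect_eq)
          with False show False ..
        qed
        then show ?thesis using H by (simp add: step_def)
      qed
      ultimately show ?thesis
        using assms(2) by (subst mult_apply[of "Supp f"]) (auto simp: Polys_def)
    qed
  qed
  ultimately show ?thesis by blast
qed

text \<open>
  At an exponent of \<open>H\<close> of the highest total degree, the coefficient of \<open>H\<close> is the coefficient of
  the product at the exponent raised by the partial degree of \<open>f\<close>.
\<close>
lemma monic_mult_eq_0:
  assumes "finite I" "f \<in> Polys I" "monic f" "H \<in> Laurent I" "f \<odot> H = 0"
  shows "H = 0"
proof (rule ccontr)
  assume "H \<noteq> 0"
  then obtain c0 where c0: "c0 \<in> Supp H" by (auto simp: fun_eq_iff Supp_def)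
  obtain d where d: "Supp H \<subseteq> {a \<in> expos I. a \<le> d}"
    using assms(4) by (auto simp: Laurent_def)
  define dist where "dist = (\<lambda>c :: expo. nat (sum d I - sum c I))"
  obtain c where c: "c \<in> Supp H" and min: "\<And>x. x \<in> Supp H \<Longrightarrow> dist c \<le> dist x"
    using ex_has_least_nat[of "\<lambda>c. c \<in> Supp H" c0 dist] c0 by auto
  have "H (c + pdeg f - b) = 0" if b: "b \<in> Supp f - {pdeg f}" for b
  proof (rule ccontr)
    let ?x = "c + pdeg f - b"
    assume "H ?x \<noteq> 0"
    then have x: "?x \<in> Supp H" by (simp add: Supp_def)
    then have "?x \<le> d" using d by auto
    then have "sum ?x I \<le> sum d I"
      by (intro sum_mono) (simp add: le_fun_def)
    moreover have "sum c I < sum ?x I"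
      using b by (intro sum_expo_raise[OF assms(1,2)]) auto
    ultimately show False using min[OF x] unfolding dist_def by linarith
  qed
  then have "(f \<odot> H) (c + pdeg f) = H c"
    by (simp add: monic_mult_apply[OF assms(2,3)])
  then show False using assms(5) c by (simp add: Supp_def)
qed

lemma monic_division_unique:
  assumes "finite I" "f \<in> Polys I" "monic f" "H \<in> Laurent I" "H' \<in> Laurent I"
    and "f \<odot> H = f \<odot> H'"
  shows "H = H'"
proof -
  have diff: "f \<odot> (H - H') = f \<odot> H - f \<odot> H'"
  proof
    fix c
    have "(f \<odot> F) c = (\<Sum>b\<in>Supp f. f b * F (c - b))" for F
      using assms(2) by (subst mult_apply[of "Supp f"]) (auto simp: Polys_def)
    then show "(f \<odot> (H - H')) c = (f \<odot> H - f \<odot> H') c"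
      by (simp add: right_diff_distrib sum_subtractf)
  qed
  have "H - H' \<in> Laurent I"
  proof -
    obtain d d' where d: "d \<in> expos I" "d' \<in> expos I"
      and "Supp H \<subseteq> {a \<in> expos I. a \<le> d}" "Supp H' \<subseteq> {a \<in> expos I. a \<le> d'}"
      using assms(4,5) by (auto simp: Laurent_def)
    moreover have "Supp (H - H') \<subseteq> Supp H \<union> Supp H'" by (auto simp: Supp_def)
    ultimately have "Supp (H - H') \<subseteq> {a \<in> expos I. a \<le> sup d d'}"
      by (blast intro: le_supI1 le_supI2)
    moreover have "sup d d' \<in> expos I" using d by (simp add: expos_def)
    ultimately show ?thesis by (auto simp: Laurent_def)
  qed
  moreover have "f \<odot> (H - H') = 0" unfolding diff assms(6) by simp
  ultimately have "H - H' = 0" by (rule monic_mult_eq_0[OF assms(1-3)])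
  then show ?thesis by simp
qed

section \<open>The decomposition, annihilators and quotients\<close>

lemma Gam_restrict: "H \<in> PowerSeries I \<Longrightarrow> Gam I (restrict H (nonpos I)) = H"
  by (auto simp: PowerSeries_def Supp_def Gam_def fun_eq_iff)

lemma Gam_inject:
  assumes "s \<in> seqs I" "t \<in> seqs I" "Gam I s = Gam I t"
  shows "s = t"
proof (rule PiE_ext[of _ "nonpos I" "\<lambda>_. UNIV"])
  fix a assume "a \<in> nonpos I"
  then show "s a = t a" using fun_cong[OF assms(3), of a] by (simp add: Gam_def)
qed (use assms in \<open>auto simp: seqs_def\<close>)

lemma Ann_iff_Gam:
  assumes "f \<in> Polys I"
  shows "f \<in> Ann I s \<longleftrightarrow> Gam I (act I f s) = 0"
proof -
  have seqs: "act I f s \<in> seqs I" "(\<lambda>b\<in>nonpos I. 0) \<in> seqs I"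
    by (simp_all add: act_def seqs_def)
  have "act I f s = (\<lambda>b\<in>nonpos I. 0) \<longleftrightarrow> Gam I (act I f s) = Gam I (\<lambda>b\<in>nonpos I. 0)"
    by (rule iffI) (simp, erule Gam_inject[OF seqs])
  moreover have "Gam I (\<lambda>b\<in>nonpos I. 0::'a) = 0" by (auto simp: Gam_def)
  ultimately show ?thesis using assms by (simp add: Ann_def)
qed

theorem corollary3p9:
  fixes n :: nat and f :: "'a::comm_ring_1 formal"
  assumes "1 \<le> n"
    and "f \<in> Polys {1..n}"
    and "ones {1..n} \<le> pdeg f"
  shows
    "(\<forall>s \<in> seqs {1..n}.
        f \<odot> Gam {1..n} s
          = (\<Sum>k = 0..2 ^ n - 2. border_prod {1..n} (border_index n k) f s)
            + Gam {1..n} (act {1..n} f s)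
        \<and> (\<forall>k \<in> {0..2 ^ n - 2}.
             Supp (border_prod {1..n} (border_index n k) f s) \<subseteq> border n k (pdeg f)))
     \<and> (\<forall>s \<in> seqs {1..n}.
          f \<in> Ann {1..n} s \<longleftrightarrow>
          f \<odot> Gam {1..n} s = (\<Sum>k = 0..2 ^ n - 2. border_prod {1..n} (border_index n k) f s))
     \<and> (\<forall>G \<in> Laurent {1..n}.
          monic f \<and> Supp G \<subseteq> interval {1..n} (- ones {1..n}) (pdeg f - ones {1..n}) \<longrightarrow>
          (\<exists>!H. H \<in> Laurent {1..n} \<and> f \<odot> H = monom 1 (ones {1..n}) \<odot> G)
          \<and> quot {1..n} (monom 1 (ones {1..n}) \<odot> G) f \<in> PowerSeries {1..n}
          \<and> (\<exists>!s. s \<in> seqs {1..n} \<and> Gam {1..n} s = quot {1..n} (monom 1 (ones {1..n}) \<odot> G) f)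
          \<and> (\<forall>s \<in> seqs {1..n}.
               Gam {1..n} s = quot {1..n} (monom 1 (ones {1..n}) \<odot> G) f \<longrightarrow>
               linear_recurring {1..n} s
               \<and> f \<in> Ann {1..n} s
               \<and> monom 1 (ones {1..n}) \<odot> G
                   = (\<Sum>k = 0..2 ^ n - 2. border_prod {1..n} (border_index n k) f s)))"
proof -
  let ?I = "{1..n}"
  let ?X = "monom 1 (ones ?I) :: 'a formal"
  let ?B = "\<lambda>s. \<Sum>k = 0..2 ^ n - 2. border_prod ?I (border_index n k) f s"
  note f = assms(2)
  have sub: "border_index n k \<subseteq> ?I" for k by (auto simp: border_index_def)
  have decomp: "f \<odot> Gam ?I s = ?B s + Gam ?I (act ?I f s)" for s
    unfolding sum.reindex_bij_betw[OF border_index_bij_proper[OF assms(1)],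
        of "\<lambda>J. border_prod ?I J f s"]
    by (rule mult_Gam_eq_border_sum[OF finite_atLeastAtMost f])
  have support: "Supp (border_prod ?I (border_index n k) f s) \<subseteq> border n k (pdeg f)" for k s
  proof
    fix c assume "c \<in> Supp (border_prod ?I (border_index n k) f s)"
    then have oct: "c \<in> octant ?I (border_index n k)" and nz: "(f \<odot> Gam ?I s) c \<noteq> 0"
      unfolding Supp_def border_prod_apply[OF finite_atLeastAtMost f sub] by (auto split: if_splits)
    have le: "c i \<le> pdeg f i" for i using mult_Gam_bounded[OF f nz] by (simp add: le_fun_def)
    have "c i \<in> (if bit k (i - 1) then {..0} else {1..pdeg f i})" if i: "i \<in> ?I" for i
    proof -
      have "c i \<le> 0 \<longleftrightarrow> bit k (i - 1)"
        using oct i by (simp add: octant_def border_index_def)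
      then show ?thesis using le[of i] by (cases "bit k (i - 1)") simp_all
    qed
    then show "c \<in> border n k (pdeg f)"
      using oct by (simp add: border_def octant_def)
  qed
  have ann: "f \<in> Ann ?I s \<longleftrightarrow> f \<odot> Gam ?I s = ?B s" for s
    by (simp only: decomp Ann_iff_Gam[OF f] add_cancel_left_right)
  \<comment> \<open>The shift by \<open>X\<^sup>1\<close> turns the interval into the exponents that are at most \<open>pdeg f\<close> but not
    nonpositive (\<open>XG\<close>): the first property gives a quotient in \<open>PowerSeries\<close>, the second one
    makes \<open>f\<close> annihilate its sequence.\<close>
  have division:
    "(\<exists>!H. H \<in> Laurent ?I \<and> f \<odot> H = ?X \<odot> G)
     \<and> quot ?I (?X \<odot> G) f \<in> PowerSeries ?I
     \<and> (\<exists>!s. s \<in> seqs ?I \<and> Gam ?I s = quot ?I (?X \<odot> G) f)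
     \<and> (\<forall>s \<in> seqs ?I. Gam ?I s = quot ?I (?X \<odot> G) f \<longrightarrow>
          linear_recurring ?I s \<and> f \<in> Ann ?I s \<and> ?X \<odot> G = ?B s)"
    if "monic f" and G: "Supp G \<subseteq> interval ?I (- ones ?I) (pdeg f - ones ?I)" for G
  proof -
    have XG: "c \<in> expos ?I \<and> c \<le> pdeg f \<and> \<not> c \<le> 0" if "(?X \<odot> G) c \<noteq> 0" for c
    proof -
      have *: "c - ones ?I \<in> expos ?I" "c - ones ?I \<le> pdeg f - ones ?I"
        "\<not> c - ones ?I \<le> - ones ?I"
        using that G by (auto simp: monom_mult_apply Supp_def interval_def)
      from expos_plus[OF *(1) expos_ones] have "c \<in> expos ?I" by simp
      then show ?thesis using *(2,3) by (auto simp: le_fun_def)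
    qed
    then have "Supp (?X \<odot> G) \<subseteq> {c \<in> expos ?I. c \<le> pdeg f}" by (auto simp: Supp_def)
    then obtain H where H: "H \<in> PowerSeries ?I" "f \<odot> H = ?X \<odot> G"
      using monic_division_exists[OF _ f \<open>monic f\<close>] by blast
    have HL: "H \<in> Laurent ?I"
      using H(1) by (auto simp: PowerSeries_def Laurent_def nonpos_def intro!: bexI[of _ 0])
    have uniq: "H' = H" if "H' \<in> Laurent ?I \<and> f \<odot> H' = ?X \<odot> G" for H'
      using that H(2)
      by (intro monic_division_unique[OF finite_atLeastAtMost f \<open>monic f\<close> _ HL]) simp_all
    have q: "quot ?I (?X \<odot> G) f = H"
      unfolding quot_def using HL H(2) uniq by (intro the_equality) blast+
    have "f \<noteq> 0" using \<open>monic f\<close> by (auto simp: monic_def)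
    have "linear_recurring ?I s \<and> f \<in> Ann ?I s \<and> ?X \<odot> G = ?B s" if "Gam ?I s = H" for s
    proof -
      have "Gam ?I (act ?I f s) = 0"
      proof (rule ext)
        show "Gam ?I (act ?I f s) c = 0 c" for c
          using XG[of c] unfolding Gam_act_apply[OF f] that H(2) by (auto simp: nonpos_def)
      qed
      then have f_Ann: "f \<in> Ann ?I s" unfolding Ann_iff_Gam[OF f] .
      then have "linear_recurring ?I s"
        using \<open>f \<noteq> 0\<close> unfolding linear_recurring_def by blast
      moreover have "?X \<odot> G = ?B s" using f_Ann unfolding ann that H(2) .
      ultimately show ?thesis using f_Ann by (intro conjI)
    qed
    moreover have "\<exists>!s. s \<in> seqs ?I \<and> Gam ?I s = H"
    proof (rule ex_ex1I)
      show "\<exists>s. s \<in> seqs ?I \<and> Gam ?I s = H"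
        using Gam_restrict[OF H(1)] by (intro exI[of _ "restrict H (nonpos ?I)"]) (simp add: seqs_def)
      show "s = t" if "s \<in> seqs ?I \<and> Gam ?I s = H" "t \<in> seqs ?I \<and> Gam ?I t = H" for s t
        using that by (intro Gam_inject[of s ?I t]) simp_all
    qed
    moreover have "\<exists>!H. H \<in> Laurent ?I \<and> f \<odot> H = ?X \<odot> G"
      using HL H(2) uniq by (intro ex1I[of _ H]) blast+
    ultimately show ?thesis
      unfolding q using H(1) by blast
  qed
  show ?thesis
    by (intro conjI ballI)
      (rule decomp, rule support, rule ann, rule impI, elim conjE, rule division, assumption+)
qed

end
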